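(* Let $c_i^\star,c_j^\star$ be a pair of constraint thresholds, $i,j\in\{1,\dots,C\}$, with corresponding quantiles $\hat\gamma_i\le\hat\gamma_j$. If $$r_i+\frac{\hat\gamma_i}{1-\hat\gamma_i}r_i^2\;\le\; r_j+\frac{\hat\gamma_j}{1-\hat\gamma_j}r_j^2,$$ then $$\frac{\partial}{\partial r_i}\prod_{k=0}^{C}r_k^{\mathrm{rel}}(\boldsymbol{x}\mid\mathcal{D})\;\ge\;\frac{\partial}{\partial r_j}\prod_{k=0}^{C}r_k^{\mathrm{rel}}(\boldsymbol{x}\mid\mathcal{D})\;\ge\;0 .$$ Moreover, equality holds in the first inequality if $\hat\gamma_i=\hat\gamma_j$ and $r_i=r_j$, and equality holds in the second inequality if and only if $\hat\gamma_j=1$.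
   Context: Fix a configuration $\boldsymbol{x}$ and a set of observations $\mathcal{D}$ for an optimization problem with one objective (index $0$) and $C$ constraints $c_k\le c_k^\star$ (indices $k=1,\dots,C$). For each $k\in\{0,\dots,C\}$, $\mathcal{D}$ is split into $\mathcal{D}_k^{(l)}$ (observations whose $k$-th value is at most the threshold) and $\mathcal{D}_k^{(g)}$ (the rest), and $\hat\gamma_k:=|\mathcal{D}_k^{(l)}|/|\mathcal{D}|\in(0,1]$ is the corresponding quantile. The density ratio $r_k=r_k(\boldsymbol{x}\mid\mathcal{D}):=p(\boldsymbol{x}\mid\mathcal{D}_k^{(l)})/p(\boldsymbol{x}\mid\mathcal{D}_k^{(g)})>0$ is the ratio of the kernel density estimators built on the two parts, and the relative density ratio is $$r_k^{\mathrm{rel}}(\boldsymbol{x}\mid\mathcal{D}):=\bigl(\hat\gamma_k+(1-\hat\gamma_k)\,r_k^{-1}\bigr)^{-1}.$$ In the partial derivatives, $r_0,\dots,r_C>0$ are regarded as independent positive real variables, and the $\hat\gamma_k$ as constants. When $\hat\gamma_k=1$, the expression $\frac{\hat\gamma_k}{1-\hat\gamma_k}r_k^2$ is interpreted as $+\infty$. *)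

theory Defs
  imports "HOL-Analysis.Analysis"
begin

text \<open>
  An observation consists of a configuration and its values, where index 0 is the objective and
  the indices \<open>1, \<dots>, C\<close> are the constraints. Likewise \<open>cstar 0\<close> is the threshold of the objective.
\<close>

type_synonym 'x observation = "'x \<times> (nat \<Rightarrow> real)"

definition lower_part :: "(nat \<Rightarrow> real) \<Rightarrow> 'x observation set \<Rightarrow> nat \<Rightarrow> 'x observation set" where
  "lower_part cstar D k = {z \<in> D. snd z k \<le> cstar k}"

definition greater_part :: "(nat \<Rightarrow> real) \<Rightarrow> 'x observation set \<Rightarrow> nat \<Rightarrow> 'x observation set" where
  "greater_part cstar D k = D - lower_part cstar D k"

definition quantile :: "(nat \<Rightarrow> real) \<Rightarrow> 'x observation set \<Rightarrow> nat \<Rightarrow> real" where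
  "quantile cstar D k = real (card (lower_part cstar D k)) / real (card D)"

text \<open>
  A kernel density estimator is a weighted mixture of kernels centred at the observed
  configurations and an optional prior component. The weights and the kernel (through its
  bandwidth) may depend on the data the estimator is built on. The prior makes the estimator
  meaningful on an empty part, which occurs as the greater part when the quantile is 1;
  \<open>prior_weight = (\<lambda>_. 0)\<close> gives an estimator without prior. Kernel, prior and weights are
  otherwise unrestricted.
\<close>

record 'x kde_scheme =
  prior_weight :: "'x observation set \<Rightarrow> real"
  prior :: "'x \<Rightarrow> real"
  weight :: "'x observation set \<Rightarrow> 'x observation \<Rightarrow> real"
  kernel :: "'x observation set \<Rightarrow> 'x \<Rightarrow> 'x \<Rightarrow> real"

definition kde :: "'x kde_scheme \<Rightarrow> 'x observation set \<Rightarrow> 'x \<Rightarrow> real" where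
  "kde E S x = prior_weight E S * prior E x + (\<Sum>z\<in>S. weight E S z * kernel E S x (fst z))"

definition density_ratio ::
    "'x kde_scheme \<Rightarrow> (nat \<Rightarrow> real) \<Rightarrow> 'x observation set \<Rightarrow> 'x \<Rightarrow> nat \<Rightarrow> real" where
  "density_ratio E cstar D x k = kde E (lower_part cstar D k) x / kde E (greater_part cstar D k) x"

definition rel_density_ratio :: "real \<Rightarrow> real \<Rightarrow> real" where
  "rel_density_ratio \<gamma> r = inverse (\<gamma> + (1 - \<gamma>) * inverse r)"

definition rel_density_product :: "nat \<Rightarrow> (nat \<Rightarrow> real) \<Rightarrow> (nat \<Rightarrow> real) \<Rightarrow> real" where
  "rel_density_product C \<gamma> r = (\<Prod>k=0..C. rel_density_ratio (\<gamma> k) (r k))"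

definition partial_deriv :: "((nat \<Rightarrow> real) \<Rightarrow> real) \<Rightarrow> nat \<Rightarrow> (nat \<Rightarrow> real) \<Rightarrow> real" where
  "partial_deriv F k r = deriv (\<lambda>t. F (r(k := t))) (r k)"

definition threshold_score :: "real \<Rightarrow> real \<Rightarrow> ereal" where
  "threshold_score \<gamma> r = (if \<gamma> = 1 then \<infinity> else ereal (r + \<gamma> / (1 - \<gamma>) * r\<^sup>2))"

text \<open>
  The constant \<^const>\<open>deriv\<close> is unspecified where a function is not differentiable; the partial
  derivatives used here do exist.
\<close>

lemma rel_density_product_differentiable:
  assumes "\<And>k. k \<le> C \<Longrightarrow> 0 < \<gamma> k \<and> \<gamma> k \<le> 1" and "\<And>k. k \<le> C \<Longrightarrow> 0 < r k" and "i \<le> C"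
  shows "(\<lambda>t. rel_density_product C \<gamma> (r(i := t))) field_differentiable at (r i)"
proof -
  have i: "i \<in> {0..C}" using assms(3) by simp
  have split: "rel_density_product C \<gamma> (r(i := t)) =
      rel_density_ratio (\<gamma> i) t * (\<Prod>k\<in>{0..C} - {i}. rel_density_ratio (\<gamma> k) (r k))" for t
    unfolding rel_density_product_def by (subst prod.remove[OF _ i]) auto
  have r: "r i > 0" and g: "0 < \<gamma> i" "\<gamma> i \<le> 1" using assms by auto
  have "0 \<le> (1 - \<gamma> i) * inverse (r i)" using r g by simp
  then have "\<gamma> i + (1 - \<gamma> i) * inverse (r i) \<noteq> 0" using g by linarith
  then have "(\<lambda>t. rel_density_ratio (\<gamma> i) t) field_differentiable at (r i)"
    unfolding rel_density_ratio_def using r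
    by (intro derivative_intros field_differentiable_inverse field_differentiable_ident) auto
  then show ?thesis unfolding split by (intro derivative_intros)
qed

end

theory Submission imports Defs begin

text \<open>
  The logarithmic derivative of \<open>r\<^sup>r\<^sup>e\<^sup>l\<close> at \<open>r\<close> is the reciprocal of the threshold score
  \<open>r + \<gamma> / (1 - \<gamma>) * r\<^sup>2\<close> (and \<open>0\<close> for \<open>\<gamma> = 1\<close>). Hence every partial derivative of the product is the
  product itself, which is positive, divided by the corresponding score.
\<close>

text \<open>Clearing the denominator \<open>1 - \<gamma>\<close> of the score makes the formula
  valid at \<open>\<gamma> = 1\<close> as well, where it gives \<open>0\<close>, the reciprocal of
  an infinite score.\<close>

definition log_slope :: "real \<Rightarrow> real \<Rightarrow> real" where
  "log_slope \<gamma> r = (1 - \<gamma>) / (r * (\<gamma> * r + (1 - \<gamma>)))"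

lemma denominator_pos:
  fixes \<gamma> r :: real
  assumes "0 < \<gamma>" "\<gamma> \<le> 1" "0 < r"
  shows "0 < \<gamma> * r + (1 - \<gamma>)"
  using assms by (simp add: add_pos_nonneg)

lemma rel_density_ratio_eq:
  assumes "0 < r"
  shows "rel_density_ratio \<gamma> r = r / (\<gamma> * r + (1 - \<gamma>))"
proof -
  have "\<gamma> + (1 - \<gamma>) * inverse r = (\<gamma> * r + (1 - \<gamma>)) / r"
    using assms by (simp add: field_simps)
  then show ?thesis
    by (simp add: rel_density_ratio_def)
qed

lemma rel_density_ratio_pos:
  assumes "0 < \<gamma>" "\<gamma> \<le> 1" "0 < r"
  shows "0 < rel_density_ratio \<gamma> r"
  using assms denominator_pos[OF assms] by (simp add: rel_density_ratio_eq)

text \<open>The numerator in the quotient rule collapses to \<open>1 - \<gamma>\<close>. Splitting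
  off the function value as a factor lets it recombine with the other factors of the product
  later.\<close>

lemma DERIV_rel_density_ratio:
  assumes "0 < \<gamma>" "\<gamma> \<le> 1" "0 < r"
  shows "(rel_density_ratio \<gamma> has_field_derivative rel_density_ratio \<gamma> r * log_slope \<gamma> r) (at r)"
proof -
  note pos = denominator_pos[OF assms]
  have "((\<lambda>t. t / (\<gamma> * t + (1 - \<gamma>))) has_field_derivative
      (1 * (\<gamma> * r + (1 - \<gamma>)) - r * \<gamma>) / ((\<gamma> * r + (1 - \<gamma>)) * (\<gamma> * r + (1 - \<gamma>)))) (at r)"
    using pos by (auto intro!: derivative_eq_intros)
  moreover have "(1 * (\<gamma> * r + (1 - \<gamma>)) - r * \<gamma>) / ((\<gamma> * r + (1 - \<gamma>)) * (\<gamma> * r + (1 - \<gamma>)))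
      = rel_density_ratio \<gamma> r * log_slope \<gamma> r"
    using assms pos by (simp add: rel_density_ratio_eq log_slope_def)
  ultimately have "((\<lambda>t. t / (\<gamma> * t + (1 - \<gamma>))) has_field_derivative
      rel_density_ratio \<gamma> r * log_slope \<gamma> r) (at r)"
    by simp
  then show ?thesis
    \<comment> \<open>The two forms disagree at \<open>t = 0\<close>, where
      \<open>inverse 0 = 0\<close>; they are identified on the positive reals, an open set
      containing \<open>r\<close>.\<close>
    by (rule has_field_derivative_transform_within_open[where S = "{0<..}"])
      (use assms in \<open>auto simp: rel_density_ratio_eq\<close>)
qed

text \<open>Only factor \<open>i\<close> varies, and its derivative contains the factor itself, so
  the full product reappears.\<close>

lemma partial_deriv_rel_density_product:
  assumes "0 < \<gamma> i" "\<gamma> i \<le> 1" "0 < r i" "i \<le> C"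
  shows "partial_deriv (rel_density_product C \<gamma>) i r
    = rel_density_product C \<gamma> r * log_slope (\<gamma> i) (r i)"
proof -
  let ?rest = "\<Prod>k\<in>{0..C} - {i}. rel_density_ratio (\<gamma> k) (r k)"
  have i: "i \<in> {0..C}"
    using assms by simp
  have split: "rel_density_product C \<gamma> (r(i := t)) = rel_density_ratio (\<gamma> i) t * ?rest" for t
    unfolding rel_density_product_def by (subst prod.remove[OF _ i]) auto
  have "((\<lambda>t. rel_density_product C \<gamma> (r(i := t))) has_field_derivative
      rel_density_ratio (\<gamma> i) (r i) * log_slope (\<gamma> i) (r i) * ?rest) (at (r i))"
    unfolding split using assms by (intro DERIV_cmult_right DERIV_rel_density_ratio)
  then show ?thesis
    \<comment> \<open>At \<open>t = r i\<close> the update is trivial, so \<open>split\<close>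
      reassembles the product at \<open>r\<close>.\<close>
    using split[of "r i"] by (simp add: partial_deriv_def DERIV_imp_deriv)
qed

lemma rel_density_product_pos:
  assumes "\<And>k. k \<le> C \<Longrightarrow> 0 < \<gamma> k \<and> \<gamma> k \<le> 1" and "\<And>k. k \<le> C \<Longrightarrow> 0 < r k"
  shows "0 < rel_density_product C \<gamma> r"
  unfolding rel_density_product_def using assms by (intro prod_pos) (simp add: rel_density_ratio_pos)

lemma log_slope_nonneg:
  assumes "0 < \<gamma>" "\<gamma> \<le> 1" "0 < r"
  shows "0 \<le> log_slope \<gamma> r"
  using assms denominator_pos[OF assms] by (simp add: log_slope_def)

lemma log_slope_eq_0_iff:
  assumes "0 < \<gamma>" "\<gamma> \<le> 1" "0 < r"
  shows "log_slope \<gamma> r = 0 \<longleftrightarrow> \<gamma> = 1"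
  using assms denominator_pos[OF assms] by (auto simp: log_slope_def)

lemma log_slope_eq_inverse_score:
  assumes "\<gamma> < 1"
  shows "log_slope \<gamma> r = inverse (r + \<gamma> / (1 - \<gamma>) * r\<^sup>2)"
proof -
  have "r + \<gamma> / (1 - \<gamma>) * r\<^sup>2 = r * (\<gamma> * r + (1 - \<gamma>)) / (1 - \<gamma>)"
    using assms by (simp add: field_simps power2_eq_square)
  then show ?thesis
    by (simp add: log_slope_def)
qed

text \<open>Taking reciprocals reverses the order of positive finite scores; an infinite score
  corresponds to slope \<open>0\<close>, the least possible value.\<close>

lemma log_slope_antimono_score:
  assumes "0 < \<gamma>" "\<gamma> \<le> 1" "0 < r" and "0 < \<gamma>'" "\<gamma>' \<le> 1" "0 < r'"
    and "threshold_score \<gamma> r \<le> threshold_score \<gamma>' r'"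
  shows "log_slope \<gamma>' r' \<le> log_slope \<gamma> r"
proof (cases "\<gamma>' = 1")
  case True
  then show ?thesis
    using log_slope_nonneg[of \<gamma> r] assms by (simp add: log_slope_def)
next
  case False
  \<comment> \<open>A finite score on the right forces a finite one on the left, which excludes
    \<open>\<gamma> = 1\<close>.\<close>
  then have lt: "\<gamma> < 1" "\<gamma>' < 1"
    using assms by (auto simp: threshold_score_def split: if_splits)
  then have "r + \<gamma> / (1 - \<gamma>) * r\<^sup>2 \<le> r' + \<gamma>' / (1 - \<gamma>') * r'\<^sup>2"
    using assms by (simp add: threshold_score_def)
  moreover have "0 < r + \<gamma> / (1 - \<gamma>) * r\<^sup>2"
    using assms lt by (simp add: add_pos_nonneg)
  ultimately show ?thesis
    using lt by (simp add: log_slope_eq_inverse_score le_imp_inverse_le)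
qed

theorem theorem1:
  fixes D :: "'x observation set" and cstar :: "nat \<Rightarrow> real" and E :: "'x kde_scheme"
    and x :: 'x and C i j :: nat and \<gamma> r :: "nat \<Rightarrow> real"
  assumes "finite D"
    and "\<gamma> = quantile cstar D"
    and "\<And>k. k \<le> C \<Longrightarrow> 0 < \<gamma> k \<and> \<gamma> k \<le> 1"
    and "r = density_ratio E cstar D x"
    and "\<And>k. k \<le> C \<Longrightarrow> 0 < r k"
    and "i \<in> {1..C}" and "j \<in> {1..C}"
    and "\<gamma> i \<le> \<gamma> j"
    and "threshold_score (\<gamma> i) (r i) \<le> threshold_score (\<gamma> j) (r j)"
  shows "partial_deriv (rel_density_product C \<gamma>) i r \<ge> partial_deriv (rel_density_product C \<gamma>) j r
    \<and> partial_deriv (rel_density_product C \<gamma>) j r \<ge> 0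
    \<and> (\<gamma> i = \<gamma> j \<and> r i = r j \<longrightarrow>
        partial_deriv (rel_density_product C \<gamma>) i r = partial_deriv (rel_density_product C \<gamma>) j r)
    \<and> (partial_deriv (rel_density_product C \<gamma>) j r = 0 \<longleftrightarrow> \<gamma> j = 1)"
proof -
  note \<gamma> = assms(3) and r = assms(5)
  have i: "i \<le> C" and j: "j \<le> C"
    using assms(6,7) by auto
  have P: "0 < rel_density_product C \<gamma> r"
    using \<gamma> r by (rule rel_density_product_pos)
  have di: "partial_deriv (rel_density_product C \<gamma>) i r
      = rel_density_product C \<gamma> r * log_slope (\<gamma> i) (r i)"
    using \<gamma>[OF i] r[OF i] i by (intro partial_deriv_rel_density_product) auto
  have dj: "partial_deriv (rel_density_product C \<gamma>) j r
      = rel_density_product C \<gamma> r * log_slope (\<gamma> j) (r j)"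
    using \<gamma>[OF j] r[OF j] j by (intro partial_deriv_rel_density_product) auto
  have "log_slope (\<gamma> j) (r j) \<le> log_slope (\<gamma> i) (r i)"
    using \<gamma>[OF i] \<gamma>[OF j] r[OF i] r[OF j] assms(9) by (intro log_slope_antimono_score) auto
  moreover have "0 \<le> log_slope (\<gamma> j) (r j)"
    using \<gamma>[OF j] r[OF j] by (intro log_slope_nonneg) auto
  moreover have "log_slope (\<gamma> j) (r j) = 0 \<longleftrightarrow> \<gamma> j = 1"
    using \<gamma>[OF j] r[OF j] by (intro log_slope_eq_0_iff) auto
  \<comment> \<open>Both derivatives share the same positive factor, so order, sign and vanishing
    are those of the slopes; equal arguments give equal slopes.\<close>
  ultimately show ?thesis
    unfolding di dj using P by auto
qed

end
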